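(* Let $H=(\Gamma,D,G,R,F)$ be a hybrid system with a forward-invariant point $z^*\in\bigsqcup_{v\in V}D_v$. Suppose there exist constants $c>0$ and $\lambda\in(0,1)$, class $\mathcal K$ functions $\underline\alpha_1,\overline\alpha_1,\underline\alpha_2,\overline\alpha_2$, and continuously differentiable maps $V_c,V_d\colon\bigsqcup_{v\in V}D_v\to\mathbb R_{\ge0}$ which are positive definite with respect to $z^*$: $$\underline\alpha_1(\|x\|_{z^*})\le V_c(x)\le\overline\alpha_1(\|x\|_{z^*}),\qquad\underline\alpha_2(\|x\|_{z^*})\le V_d(x)\le\overline\alpha_2(\|x\|_{z^*}),$$ and which satisfy, for all $v\in V$ and $x\in D_v$, $$\frac{dV_c}{dt}(x)\cdot f_v(x)\le-c,\qquad\frac{dV_d}{dt}(x)\cdot f_v(x)\le0,$$ and, for all $e\in E$ and $x\in G_e$, $$V_c(x)=0,\qquad V_d(R_e(x))\le\lambda V_d(x),\qquad V_c(R_e(x))\le V_d(x).$$ Then for any execution $\chi=(\Lambda,I,\rho,C)$ of $H$ with inter-jump durations $\Delta t_k:=\tau_{k+1}-\tau_k$, $$\sum_{k\in\Lambda}\Delta t_k\le\frac{V_c(c_0(\tau_0))}{c}+\frac{V_d(c_0(\tau_0))}{c(1-\lambda)}<\infty.$$ In particular, if $\Lambda=\mathbb N$, then $\chi$ is a Zeno execution.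
   Context: Hybrid system $H=(\Gamma,D,G,R,F)$: $\Gamma=(V,E)$ is a directed graph with source and target maps $s,t\colon E\to V$; $D=\{D_v\}_{v\in V}$ are smooth manifolds (possibly with boundary); $G=\{G_e\}_{e\in E}$ are guards $G_e\subseteq D_{s(e)}$; $R=\{R_e\}_{e\in E}$ are smooth reset maps $R_e\colon G_e\to D_{t(e)}$; $F=\{f_v\}_{v\in V}$ are vector fields $f_v$ on $D_v$. Guards of edges with a common source are assumed disjoint. An execution $\chi=(\Lambda,I,\rho,C)$ consists of an index set $\Lambda$ ($\mathbb N$ or $\{0,\dots,n-1\}$), intervals $I_j=[\tau_j,\tau_{j+1}]$, a map $\rho\colon\Lambda\to V$ and trajectories $C=\{c_j\colon I_j\to D_{\rho(j)}\}$ with $\frac{d}{dt}c_j(t)=f_{\rho(j)}(c_j(t))$ and, for $j,j+1\in\Lambda$ and $e=(\rho(j),\rho(j+1))\in E$, $c_j(\tau_{j+1})\in G_e$ and $c_{j+1}(\tau_{j+1})=R_e(c_j(\tau_{j+1}))$. It is a Zeno execution if $\Lambda=\mathbb N$ and $\lim_{j\to\infty}\tau_j<\infty$. A point $z^*$ is forward invariant if every execution starting at $z^*$ remains at $z^*$. $\|x\|_{z^*}:=d(x,z^* )$, where $d$ is a given semi-metric on $\bigsqcup_vD_v$: $d(x,y)\ge0$, with $d(x,y)=0$ iff $x=y$. A class $\mathcal K$ function is a smooth strictly increasing $\alpha\colon\mathbb R_{\ge0}\to\mathbb R_{\ge0}$ with $\alpha(0)=0$ having an order-preserving (smooth) inverse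 $\mathbb R_{\ge0}\to\mathbb R_{\ge0}$. The expression $\frac{dV_c}{dt}(x)\cdot f_v(x)$ is the derivative of $V_c$ along $f_v$ at $x$. *)

theory Defs
  imports "HOL-Analysis.Analysis" "Graph_Theory.Digraph"
begin

section \<open>Differentiability on relatively open subsets of half-spaces\<close>

text \<open>
  Points of R^n are functions nat to real that vanish from index n on
  (\<^const>\<open>Euclidean_space\<close>), so that the dimension may vary from manifold to manifold.
  For n = 0 the inequality below is automatic and the half-space is a single point.
\<close>

definition half_space :: "nat \<Rightarrow> (nat \<Rightarrow> real) topology" where
  "half_space n = subtopology (Euclidean_space n) {x. 0 \<le> x 0}"

text \<open>
  Partial derivatives are taken within the domain \<open>A\<close>. When \<open>A\<close> is open in the half-space,
  this is the ordinary partial derivative, except that in direction 0 at a boundary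
  point it is one-sided.
\<close>

definition slice :: "(nat \<Rightarrow> real) set \<Rightarrow> nat \<Rightarrow> (nat \<Rightarrow> real) \<Rightarrow> real set" where
  "slice A i x = {s. x(i := s) \<in> A}"

definition has_partial ::
    "(nat \<Rightarrow> real) set \<Rightarrow> nat \<Rightarrow> ((nat \<Rightarrow> real) \<Rightarrow> real) \<Rightarrow> (nat \<Rightarrow> real) \<Rightarrow> bool" where
  "has_partial A i f x \<longleftrightarrow> (\<lambda>s. f (x(i := s))) differentiable (at (x i) within slice A i x)"

definition partial ::
    "(nat \<Rightarrow> real) set \<Rightarrow> nat \<Rightarrow> ((nat \<Rightarrow> real) \<Rightarrow> real) \<Rightarrow> (nat \<Rightarrow> real) \<Rightarrow> real" where
  "partial A i f x = vector_derivative (\<lambda>s. f (x(i := s))) (at (x i) within slice A i x)"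

text \<open>
  Used only for \<open>A\<close> open in the half-space. There it agrees with the existence of local
  \<open>C\<^sup>k\<close> extensions to open subsets of R^n (extension by reflection).
\<close>

primrec Ck_on :: "nat \<Rightarrow> nat \<Rightarrow> (nat \<Rightarrow> real) set \<Rightarrow> ((nat \<Rightarrow> real) \<Rightarrow> real) \<Rightarrow> bool" where
  "Ck_on n 0 A f \<longleftrightarrow> continuous_map (subtopology (Euclidean_space n) A) euclideanreal f"
| "Ck_on n (Suc k) A f \<longleftrightarrow>
     continuous_map (subtopology (Euclidean_space n) A) euclideanreal f \<and>
     (\<forall>i<n. (\<forall>x\<in>A. has_partial A i f x) \<and> Ck_on n k A (partial A i f))"

definition smooth_on_half_space ::
    "nat \<Rightarrow> (nat \<Rightarrow> real) set \<Rightarrow> ((nat \<Rightarrow> real) \<Rightarrow> real) \<Rightarrow> bool" where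
  "smooth_on_half_space n A f \<longleftrightarrow> (\<forall>k. Ck_on n k A f)"


section \<open>Smooth manifolds with (possibly empty) boundary\<close>

type_synonym 'p chart = "'p set \<times> ('p \<Rightarrow> nat \<Rightarrow> real)"

record 'p manifold =
  mf_top :: "'p topology"
  mf_dim :: nat
  mf_atlas :: "'p chart set"

abbreviation points :: "'p manifold \<Rightarrow> 'p set" where
  "points M \<equiv> topspace (mf_top M)"

definition chart_image :: "'p chart \<Rightarrow> 'p set \<Rightarrow> (nat \<Rightarrow> real) set" where
  "chart_image \<kappa> S = snd \<kappa> ` (fst \<kappa> \<inter> S)"

definition in_chart :: "'p chart \<Rightarrow> ('p \<Rightarrow> 'b) \<Rightarrow> (nat \<Rightarrow> real) \<Rightarrow> 'b" where
  "in_chart \<kappa> g y = g (inv_into (fst \<kappa>) (snd \<kappa>) y)"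

definition is_chart :: "'p manifold \<Rightarrow> 'p chart \<Rightarrow> bool" where
  "is_chart M \<kappa> \<longleftrightarrow>
     openin (mf_top M) (fst \<kappa>) \<and>
     openin (half_space (mf_dim M)) (snd \<kappa> ` fst \<kappa>) \<and>
     homeomorphic_map (subtopology (mf_top M) (fst \<kappa>))
       (subtopology (half_space (mf_dim M)) (snd \<kappa> ` fst \<kappa>)) (snd \<kappa>)"

definition smooth_manifold :: "'p manifold \<Rightarrow> bool" where
  "smooth_manifold M \<longleftrightarrow>
     Hausdorff_space (mf_top M) \<and> second_countable (mf_top M) \<and>
     (\<Union>\<kappa>\<in>mf_atlas M. fst \<kappa>) = points M \<and>
     (\<forall>\<kappa>\<in>mf_atlas M. is_chart M \<kappa>) \<and>
     (\<forall>\<kappa>\<in>mf_atlas M. \<forall>\<kappa>'\<in>mf_atlas M. \<forall>i<mf_dim M.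
        smooth_on_half_space (mf_dim M) (chart_image \<kappa> (fst \<kappa>'))
          (in_chart \<kappa> (\<lambda>p. snd \<kappa>' p i)))"

text \<open>
  A map on an arbitrary subset \<open>S\<close> is smooth if near each point of \<open>S\<close> it extends to a smooth
  map from an open subset of \<open>M\<close> into \<open>N\<close>.
\<close>

definition smooth_map_on :: "'p manifold \<Rightarrow> 'p set \<Rightarrow> 'q manifold \<Rightarrow> ('p \<Rightarrow> 'q) \<Rightarrow> bool" where
  "smooth_map_on M S N f \<longleftrightarrow>
     f ` S \<subseteq> points N \<and>
     (\<forall>p\<in>S. \<exists>\<kappa>\<in>mf_atlas M. \<exists>\<kappa>'\<in>mf_atlas N. \<exists>U g.
        openin (mf_top M) U \<and> p \<in> U \<and> U \<subseteq> fst \<kappa> \<and>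
        g ` U \<subseteq> fst \<kappa>' \<and> (\<forall>x\<in>S \<inter> U. g x = f x) \<and>
        (\<forall>i<mf_dim N. smooth_on_half_space (mf_dim M) (chart_image \<kappa> U)
           (in_chart \<kappa> (\<lambda>x. snd \<kappa>' (g x) i))))"

definition C1_function :: "'p manifold \<Rightarrow> ('p \<Rightarrow> real) \<Rightarrow> bool" where
  "C1_function M g \<longleftrightarrow>
     (\<forall>\<kappa>\<in>mf_atlas M. Ck_on (mf_dim M) 1 (chart_image \<kappa> (fst \<kappa>)) (in_chart \<kappa> g))"

text \<open>
  A tangent vector at \<open>p\<close> is given by its components in every chart around \<open>p\<close>, related by the
  Jacobians of the transition maps. At boundary points this is the full tangent space.
\<close>

type_synonym 'p tangent = "'p chart \<Rightarrow> nat \<Rightarrow> real"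

definition tangent_vector :: "'p manifold \<Rightarrow> 'p \<Rightarrow> 'p tangent \<Rightarrow> bool" where
  "tangent_vector M p w \<longleftrightarrow>
     (\<forall>\<kappa>\<in>mf_atlas M. \<forall>\<kappa>'\<in>mf_atlas M. p \<in> fst \<kappa> \<inter> fst \<kappa>' \<longrightarrow>
        (\<forall>i<mf_dim M. w \<kappa>' i =
           (\<Sum>j<mf_dim M.
              partial (chart_image \<kappa> (fst \<kappa>')) j (in_chart \<kappa> (\<lambda>q. snd \<kappa>' q i)) (snd \<kappa> p)
              * w \<kappa> j)))"

definition vector_field :: "'p manifold \<Rightarrow> ('p \<Rightarrow> 'p tangent) \<Rightarrow> bool" where
  "vector_field M X \<longleftrightarrow> (\<forall>p\<in>points M. tangent_vector M p (X p))"

text \<open>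
  The derivative of \<open>g\<close> at \<open>p\<close> along \<open>w\<close>, computed in some chart around \<open>p\<close>; for
  \<open>C\<^sup>1\<close> functions and tangent vectors the value does not depend on the chart.
\<close>

definition derivative_along :: "'p manifold \<Rightarrow> ('p \<Rightarrow> real) \<Rightarrow> 'p \<Rightarrow> 'p tangent \<Rightarrow> real" where
  "derivative_along M g p w =
     (let \<kappa> = (SOME \<kappa>. \<kappa> \<in> mf_atlas M \<and> p \<in> fst \<kappa>)
      in \<Sum>i<mf_dim M. partial (chart_image \<kappa> (fst \<kappa>)) i (in_chart \<kappa> g) (snd \<kappa> p) * w \<kappa> i)"

text \<open>
  The derivative is one-sided at the end points. If \<open>a = b\<close>, it is taken along the
  trivial filter and imposes no condition. Outside the chart domain the coordinates of \<open>c s\<close>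
  are meaningless, but by continuity \<open>c s\<close> lies in it for \<open>s\<close> near \<open>t\<close>.
\<close>

definition integral_curve ::
    "'p manifold \<Rightarrow> ('p \<Rightarrow> 'p tangent) \<Rightarrow> real \<Rightarrow> real \<Rightarrow> (real \<Rightarrow> 'p) \<Rightarrow> bool" where
  "integral_curve M X a b c \<longleftrightarrow>
     continuous_map (top_of_set {a..b}) (mf_top M) c \<and>
     (\<forall>t\<in>{a..b}. \<forall>\<kappa>\<in>mf_atlas M. c t \<in> fst \<kappa> \<longrightarrow>
        (\<forall>i<mf_dim M.
           ((\<lambda>s. snd \<kappa> (c s) i) has_real_derivative X (c t) \<kappa> i) (at t within {a..b})))"


section \<open>Hybrid systems\<close>

record ('v, 'e, 'p) hybrid_system =
  hs_graph :: "('v, 'e) pre_digraph"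
  hs_dom :: "'v \<Rightarrow> 'p manifold"
  hs_guard :: "'e \<Rightarrow> 'p set"
  hs_reset :: "'e \<Rightarrow> 'p \<Rightarrow> 'p"
  hs_field :: "'v \<Rightarrow> 'p \<Rightarrow> 'p tangent"

definition hybrid_system :: "('v, 'e, 'p) hybrid_system \<Rightarrow> bool" where
  "hybrid_system H \<longleftrightarrow>
     wf_digraph (hs_graph H) \<and>
     (\<forall>v\<in>verts (hs_graph H).
        smooth_manifold (hs_dom H v) \<and> vector_field (hs_dom H v) (hs_field H v)) \<and>
     (\<forall>e\<in>arcs (hs_graph H).
        hs_guard H e \<subseteq> points (hs_dom H (tail (hs_graph H) e)) \<and>
        smooth_map_on (hs_dom H (tail (hs_graph H) e)) (hs_guard H e)
          (hs_dom H (head (hs_graph H) e)) (hs_reset H e)) \<and>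
     (\<forall>e\<in>arcs (hs_graph H). \<forall>e'\<in>arcs (hs_graph H).
        e \<noteq> e' \<and> tail (hs_graph H) e = tail (hs_graph H) e' \<longrightarrow>
        hs_guard H e \<inter> hs_guard H e' = {})"

definition hs_points :: "('v, 'e, 'p) hybrid_system \<Rightarrow> ('v \<times> 'p) set" where
  "hs_points H = (SIGMA v:verts (hs_graph H). points (hs_dom H v))"

record ('v, 'p) execution =
  ex_index :: "nat set"
  ex_time :: "nat \<Rightarrow> real"
  ex_vert :: "nat \<Rightarrow> 'v"
  ex_curve :: "nat \<Rightarrow> real \<Rightarrow> 'p"

definition execution :: "('v, 'e, 'p) hybrid_system \<Rightarrow> ('v, 'p) execution \<Rightarrow> bool" where
  "execution H \<xi> \<longleftrightarrow>
     (ex_index \<xi> = UNIV \<or> (\<exists>n\<ge>1. ex_index \<xi> = {..<n})) \<and>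
     (\<forall>j\<in>ex_index \<xi>.
        ex_time \<xi> j \<le> ex_time \<xi> (Suc j) \<and>
        ex_vert \<xi> j \<in> verts (hs_graph H) \<and>
        integral_curve (hs_dom H (ex_vert \<xi> j)) (hs_field H (ex_vert \<xi> j))
          (ex_time \<xi> j) (ex_time \<xi> (Suc j)) (ex_curve \<xi> j)) \<and>
     (\<forall>j. j \<in> ex_index \<xi> \<and> Suc j \<in> ex_index \<xi> \<longrightarrow>
        (\<exists>e\<in>arcs (hs_graph H).
           tail (hs_graph H) e = ex_vert \<xi> j \<and> head (hs_graph H) e = ex_vert \<xi> (Suc j) \<and>
           ex_curve \<xi> j (ex_time \<xi> (Suc j)) \<in> hs_guard H e \<and>
           ex_curve \<xi> (Suc j) (ex_time \<xi> (Suc j)) =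
             hs_reset H e (ex_curve \<xi> j (ex_time \<xi> (Suc j)))))"

definition ex_state :: "('v, 'p) execution \<Rightarrow> nat \<Rightarrow> real \<Rightarrow> 'v \<times> 'p" where
  "ex_state \<xi> j t = (ex_vert \<xi> j, ex_curve \<xi> j t)"

definition ex_start :: "('v, 'p) execution \<Rightarrow> 'v \<times> 'p" where
  "ex_start \<xi> = ex_state \<xi> 0 (ex_time \<xi> 0)"

definition ex_duration :: "('v, 'p) execution \<Rightarrow> nat \<Rightarrow> real" where
  "ex_duration \<xi> k = ex_time \<xi> (Suc k) - ex_time \<xi> k"

text \<open>
  The jump times of an infinite execution are nondecreasing, so convergence in the reals
  says that their limit is finite.
\<close>

definition zeno_execution :: "('v, 'e, 'p) hybrid_system \<Rightarrow> ('v, 'p) execution \<Rightarrow> bool" where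
  "zeno_execution H \<xi> \<longleftrightarrow>
     execution H \<xi> \<and> ex_index \<xi> = UNIV \<and> convergent (ex_time \<xi>)"

definition forward_invariant :: "('v, 'e, 'p) hybrid_system \<Rightarrow> 'v \<times> 'p \<Rightarrow> bool" where
  "forward_invariant H z \<longleftrightarrow>
     (\<forall>\<xi>. execution H \<xi> \<and> ex_start \<xi> = z \<longrightarrow>
        (\<forall>j\<in>ex_index \<xi>. \<forall>t\<in>{ex_time \<xi> j..ex_time \<xi> (Suc j)}. ex_state \<xi> j t = z))"


section \<open>Lyapunov data\<close>

text \<open>Neither symmetry nor the triangle inequality is required.\<close>

definition semi_metric_on :: "'a set \<Rightarrow> ('a \<Rightarrow> 'a \<Rightarrow> real) \<Rightarrow> bool" where
  "semi_metric_on S d \<longleftrightarrow> (\<forall>x\<in>S. \<forall>y\<in>S. 0 \<le> d x y \<and> (d x y = 0 \<longleftrightarrow> x = y))"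

definition smooth_on_nonneg :: "(real \<Rightarrow> real) \<Rightarrow> bool" where
  "smooth_on_nonneg f \<longleftrightarrow>
     (\<exists>D :: nat \<Rightarrow> real \<Rightarrow> real. (\<forall>x\<ge>0. D 0 x = f x) \<and>
        (\<forall>k. \<forall>x\<ge>0. (D k has_real_derivative D (Suc k) x) (at x within {0..})))"

definition class_K :: "(real \<Rightarrow> real) \<Rightarrow> bool" where
  "class_K \<alpha> \<longleftrightarrow>
     \<alpha> ` {0..} \<subseteq> {0..} \<and> smooth_on_nonneg \<alpha> \<and> strict_mono_on {0..} \<alpha> \<and> \<alpha> 0 = 0 \<and>
     (\<exists>\<beta>. \<beta> ` {0..} \<subseteq> {0..} \<and> smooth_on_nonneg \<beta> \<and> mono_on {0..} \<beta> \<and>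
        (\<forall>x\<ge>0. \<beta> (\<alpha> x) = x \<and> \<alpha> (\<beta> x) = x))"

definition C1_on_system :: "('v, 'e, 'p) hybrid_system \<Rightarrow> ('v \<times> 'p \<Rightarrow> real) \<Rightarrow> bool" where
  "C1_on_system H W \<longleftrightarrow>
     (\<forall>v\<in>verts (hs_graph H). C1_function (hs_dom H v) (\<lambda>x. W (v, x)))"

definition flow_derivative ::
    "('v, 'e, 'p) hybrid_system \<Rightarrow> ('v \<times> 'p \<Rightarrow> real) \<Rightarrow> 'v \<Rightarrow> 'p \<Rightarrow> real" where
  "flow_derivative H W v x =
     derivative_along (hs_dom H v) (\<lambda>y. W (v, y)) x (hs_field H v x)"

end

theory Submission
  imports Defs
begin

text \<open>
  Along the flow \<open>V\<^sub>c\<close> decreases at rate at least \<open>c\<close> and is nonnegative, so a trajectory that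
  starts with the value \<open>V\<^sub>c = a\<close> lasts at most \<open>a / c\<close>. Write \<open>V\<^sub>d\<^sup>k\<close> for the value of \<open>V\<^sub>d\<close> at the start
  of trajectory \<open>k\<close>. Since \<open>V\<^sub>d\<close> does not increase along the flow and contracts by the factor \<open>l\<close> at each
  jump, \<open>V\<^sub>d\<^sup>k\<close> is at most \<open>l ^ k\<close> times its initial value. After a jump, \<open>V\<^sub>c\<close> is bounded by the
  value of \<open>V\<^sub>d\<close> before it, so trajectory \<open>k + 1\<close> lasts at most \<open>V\<^sub>d\<^sup>k / c\<close>, and the durations are
  dominated by a geometric series.

  What needs care is that a Lie derivative, defined by one-sided partial derivatives in a chart, controls
  the values of a \<open>C\<^sup>1\<close> function along an integral curve even where the curve touches the
  boundary of the manifold (\<open>has_real_derivative_along_integral_curve\<close>). This is a chain rule on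
  relatively open subsets of a half-space (\<open>half_space_chain_rule\<close>). It is proved by changing one
  coordinate at a time: the half-space is a product of intervals, so such a coordinate path does not
  leave it, and the one-dimensional mean value theorem applies to each step.
\<close>

section \<open>Chain rule in a half-space\<close>

text \<open>
  The partial derivative is taken within the whole slice, so it is in particular a derivative
  within each segment of the slice, also when the segment ends on the boundary.
\<close>

lemma partial_mean_value:
  assumes seg: "\<And>u. u \<in> closed_segment a b \<Longrightarrow> y(k := u) \<in> A"
    and der: "\<And>x. x \<in> A \<Longrightarrow> has_partial A k f x"
  shows "\<exists>u\<in>closed_segment a b. f (y(k := b)) - f (y(k := a)) = partial A k f (y(k := u)) * (b - a)"
proof -
  have mvt: "\<exists>u\<in>{p..q}. f (y(k := q)) - f (y(k := p)) = partial A k f (y(k := u)) * (q - p)"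
    if "p \<le> q" and sub: "{p..q} \<subseteq> closed_segment a b" for p q
  proof -
    have "((\<lambda>s. f (y(k := s))) has_derivative (\<lambda>h. partial A k f (y(k := u)) * h))
            (at u within {p..q})" if u: "p \<le> u" "u \<le> q" for u
    proof -
      let ?S = "slice A k (y(k := u))"
      have "y(k := u) \<in> A"
        using seg sub u by auto
      then have "((\<lambda>s. f (y(k := s))) has_vector_derivative partial A k f (y(k := u))) (at u within ?S)"
        using der[of "y(k := u)"] unfolding has_partial_def partial_def
        by (simp add: vector_derivative_works)
      moreover have "{p..q} \<subseteq> ?S"
        using seg sub by (auto simp: slice_def)
      ultimately have "((\<lambda>s. f (y(k := s))) has_vector_derivative partial A k f (y(k := u)))
          (at u within {p..q})"
        by (rule has_vector_derivative_within_subset)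
      then show ?thesis
        by (simp add: has_vector_derivative_def mult.commute)
    qed
    then show ?thesis
      using mvt_very_simple[OF \<open>p \<le> q\<close>, of "\<lambda>s. f (y(k := s))"
          "\<lambda>u h. partial A k f (y(k := u)) * h"] by blast
  qed
  show ?thesis
  proof (cases "a \<le> b")
    case True
    then show ?thesis
      using mvt[of a b] by (auto simp: closed_segment_eq_real_ivl)
  next
    case False
    then obtain u where "u \<in> {b..a}"
      "f (y(k := a)) - f (y(k := b)) = partial A k f (y(k := u)) * (a - b)"
      using mvt[of b a] by (auto simp: closed_segment_eq_real_ivl)
    then show ?thesis
      using False by (intro bexI[of _ u]) (auto simp: closed_segment_eq_real_ivl algebra_simps)
  qed
qed

lemma limitin_half_space:
  assumes "\<And>i. ((\<lambda>s. p s i) \<longlongrightarrow> x i) F"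
    and "\<forall>\<^sub>F s in F. p s \<in> topspace (half_space n)"
    and "x \<in> topspace (half_space n)"
  shows "limitin (half_space n) p x F"
proof -
  have "half_space n = subtopology (powertop_real UNIV) ({x. \<forall>i\<ge>n. x i = 0} \<inter> {x. 0 \<le> x 0})"
    by (simp add: half_space_def Euclidean_space_def subtopology_subtopology)
  then show ?thesis
    using assms by (simp add: limitin_subtopology limitin_componentwise)
qed

lemma topspace_half_space:
  "topspace (half_space n) = {x. (\<forall>i\<ge>n. x i = 0) \<and> 0 \<le> x 0}"
  by (auto simp: half_space_def topspace_Euclidean_space)

text \<open>
  Passing from \<open>\<gamma> t\<close> to \<open>\<gamma> s\<close> one coordinate at a time splits the increment of \<open>f\<close> into \<open>n\<close> steps. By the
  mean value theorem, step \<open>k\<close> is the increment of the coordinate \<open>k\<close> of \<open>\<gamma>\<close> times a value of the partial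
  derivative near \<open>\<gamma> t\<close>, and continuity of the partial derivative gives the limit. The set \<open>T\<close> is
  arbitrary so that one-sided derivatives at the ends of a curve are covered.
\<close>

theorem half_space_chain_rule:
  assumes A: "openin (half_space n) A"
    and f: "Ck_on n 1 A f"
    and \<gamma>A: "\<forall>\<^sub>F s in at t within T. \<gamma> s \<in> A" and \<gamma>t: "\<gamma> t \<in> A"
    and \<gamma>: "\<And>i. i < n \<Longrightarrow> ((\<lambda>s. \<gamma> s i) has_real_derivative w i) (at t within T)"
  shows "((\<lambda>s. f (\<gamma> s)) has_real_derivative (\<Sum>i<n. partial A i f (\<gamma> t) * w i)) (at t within T)"
proof -
  let ?F = "at t within T"
  let ?x = "\<gamma> t"
  \<comment> \<open>the first \<open>k\<close> coordinates follow the curve, the others are still those of the base point\<close>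
  define y where "y k s = (\<lambda>i. if i < k then \<gamma> s i else ?x i)" for k s
  have A_sub: "A \<subseteq> topspace (half_space n)"
    using A by (rule openin_subset)
  have \<gamma>H: "\<forall>\<^sub>F s in ?F. \<gamma> s \<in> topspace (half_space n)"
    using \<gamma>A A_sub by (auto elim: eventually_mono)
  have xH: "?x \<in> topspace (half_space n)"
    using \<gamma>t A_sub by auto
  have f1: "has_partial A i f x" if "i < n" "x \<in> A" for i x
    using f that by simp
  have f2: "continuous_map (subtopology (half_space n) A) euclideanreal (partial A i f)" if "i < n" for i
  proof -
    have "A = {x. 0 \<le> x 0} \<inter> A"
      using A_sub by (auto simp: topspace_half_space)
    then have "subtopology (half_space n) A = subtopology (Euclidean_space n) A"
      by (metis half_space_def subtopology_subtopology)
    then show ?thesis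
      using f that by simp
  qed
  have \<gamma>lim: "((\<lambda>s. \<gamma> s i) \<longlongrightarrow> ?x i) ?F" for i
  proof (cases "i < n")
    case True
    then show ?thesis
      using \<gamma>[THEN DERIV_continuous] by (simp add: continuous_within)
  next
    case False
    have "\<forall>\<^sub>F s in ?F. ?x i = \<gamma> s i"
      using \<gamma>H by eventually_elim (use xH False in \<open>auto simp: topspace_half_space\<close>)
    then show ?thesis
      by (rule Lim_transform_eventually[OF tendsto_const])
  qed
  \<comment> \<open>any intermediate point of the \<open>k\<close>-th coordinate step tends to the base point\<close>
  have step_lim: "limitin (half_space n) (\<lambda>s. (y k s)(k := \<theta> s)) ?x ?F"
    if k: "k < n" and \<theta>: "\<And>s. \<theta> s \<in> closed_segment (?x k) (\<gamma> s k)" for k \<theta>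
  proof (rule limitin_half_space)
    fix i
    have between: "min (?x k) (\<gamma> s k) \<le> \<theta> s \<and> \<theta> s \<le> max (?x k) (\<gamma> s k)" for s
      using \<theta>[of s] by (auto simp: closed_segment_eq_real_ivl split: if_splits)
    have "(\<theta> \<longlongrightarrow> ?x k) ?F"
    proof (rule tendsto_sandwich[where f = "\<lambda>s. min (?x k) (\<gamma> s k)" and h = "\<lambda>s. max (?x k) (\<gamma> s k)"])
      show "((\<lambda>s. min (?x k) (\<gamma> s k)) \<longlongrightarrow> ?x k) ?F"
        using tendsto_min[OF tendsto_const[of "?x k"] \<gamma>lim[of k]] by simp
      show "((\<lambda>s. max (?x k) (\<gamma> s k)) \<longlongrightarrow> ?x k) ?F"
        using tendsto_max[OF tendsto_const[of "?x k"] \<gamma>lim[of k]] by simp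
    qed (simp_all only: between always_eventually simp_thms)
    then show "((\<lambda>s. ((y k s)(k := \<theta> s)) i) \<longlongrightarrow> ?x i) ?F"
      using \<gamma>lim[of i] by (cases "i < k"; cases "i = k") (simp_all add: y_def)
  next
    show "\<forall>\<^sub>F s in ?F. (y k s)(k := \<theta> s) \<in> topspace (half_space n)"
      using \<gamma>H
    proof eventually_elim
      case (elim s)
      then have "0 \<le> \<theta> s" if "k = 0"
        using that \<theta>[of s] xH
        by (auto simp: closed_segment_eq_real_ivl topspace_half_space split: if_splits)
      then show ?case
        using elim xH k by (auto simp: y_def topspace_half_space)
    qed
  qed (rule xH)
  have step_der: "((\<lambda>s. f (y (Suc k) s) - f (y k s)) has_real_derivative partial A k f ?x * w k) ?F"
    if k: "k < n" for k
  proof -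
    \<comment> \<open>Near \<open>t\<close> the whole \<open>k\<close>-th segment lies in \<open>A\<close>: choose a point outside \<open>A\<close> on each segment
        that has one; these points would tend to the base point.\<close>
    define bad where "bad s u \<longleftrightarrow> u \<in> closed_segment (?x k) (\<gamma> s k) \<and> (y k s)(k := u) \<notin> A" for s u
    define \<theta> where "\<theta> s = (if \<exists>u. bad s u then SOME u. bad s u else ?x k)" for s
    have \<theta>_bad: "bad s (\<theta> s)" if "bad s u" for s u
      using that someI_ex[of "bad s"] by (auto simp: \<theta>_def)
    have "\<theta> s \<in> closed_segment (?x k) (\<gamma> s k)" for s
      using someI_ex[of "bad s"] by (auto simp: \<theta>_def bad_def)
    then have "\<forall>\<^sub>F s in ?F. (y k s)(k := \<theta> s) \<in> A"
      using step_lim[OF k, of \<theta>] A \<gamma>t by (auto simp: limitin_def)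
    then have seg: "\<forall>\<^sub>F s in ?F. \<forall>u\<in>closed_segment (?x k) (\<gamma> s k). (y k s)(k := u) \<in> A"
      by eventually_elim (use \<theta>_bad bad_def in blast)
    \<comment> \<open>mean value points \<open>\<eta> s\<close> on the segments; the partial derivatives there converge by continuity\<close>
    define mean where "mean s u \<longleftrightarrow> u \<in> closed_segment (?x k) (\<gamma> s k) \<and>
      f (y (Suc k) s) - f (y k s) = partial A k f ((y k s)(k := u)) * (\<gamma> s k - ?x k)" for s u
    define \<eta> where "\<eta> s = (if \<exists>u. mean s u then SOME u. mean s u else ?x k)" for s
    have \<eta>_mean: "mean s (\<eta> s)" if "mean s u" for s u
      using that someI_ex[of "mean s"] by (auto simp: \<eta>_def)
    have \<eta>_seg: "\<eta> s \<in> closed_segment (?x k) (\<gamma> s k)" for s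
      using someI_ex[of "mean s"] by (auto simp: \<eta>_def mean_def)
    have y_upd: "(y k s)(k := \<gamma> s k) = y (Suc k) s" "(y k s)(k := ?x k) = y k s" for s
      by (auto simp: y_def fun_eq_iff less_Suc_eq)
    have mean: "\<forall>\<^sub>F s in ?F. mean s (\<eta> s)"
      using seg
    proof eventually_elim
      case (elim s)
      have "\<exists>u. mean s u"
        using partial_mean_value[of "?x k" "\<gamma> s k" "y k s" k A f] elim f1[OF k]
        unfolding mean_def y_upd by blast
      then show ?case
        using \<eta>_mean by blast
    qed
    define q where "q s = partial A k f ((y k s)(k := \<eta> s))" for s
    have "limitin (subtopology (half_space n) A) (\<lambda>s. (y k s)(k := \<eta> s)) ?x ?F"
      using step_lim[OF k \<eta>_seg] seg \<eta>_seg \<gamma>t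
      by (auto simp: limitin_subtopology elim: eventually_mono)
    from continuous_map_limit[OF f2[OF k] this]
    have q: "(q \<longlongrightarrow> partial A k f ?x) ?F"
      by (simp add: q_def[abs_def] o_def)
    have "((\<lambda>s. (\<gamma> s k - ?x k) / (s - t)) \<longlongrightarrow> w k) ?F"
      using \<gamma>[OF k] by (simp add: has_field_derivative_iff)
    from tendsto_mult[OF q this]
    have "((\<lambda>s. q s * ((\<gamma> s k - ?x k) / (s - t))) \<longlongrightarrow> partial A k f ?x * w k) ?F" .
    moreover have "\<forall>\<^sub>F s in ?F. q s * ((\<gamma> s k - ?x k) / (s - t))
        = ((f (y (Suc k) s) - f (y k s)) - (f (y (Suc k) t) - f (y k t))) / (s - t)"
      using mean
    proof eventually_elim
      case (elim s)
      have "y (Suc k) t = y k t"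
        by (simp add: y_def fun_eq_iff)
      then show ?case
        using elim by (simp add: mean_def q_def)
    qed
    ultimately show ?thesis
      unfolding has_field_derivative_iff by (rule Lim_transform_eventually)
  qed
  have "((\<lambda>s. f ?x + (\<Sum>k<n. f (y (Suc k) s) - f (y k s))) has_real_derivative
      0 + (\<Sum>k<n. partial A k f ?x * w k)) ?F"
    by (intro DERIV_add DERIV_const DERIV_sum step_der) simp
  moreover have "\<forall>\<^sub>F s in ?F. f ?x + (\<Sum>k<n. f (y (Suc k) s) - f (y k s)) = f (\<gamma> s)"
    using \<gamma>H
  proof eventually_elim
    case (elim s)
    then have "y n s = \<gamma> s" "y 0 s = ?x"
      using xH by (auto simp: y_def topspace_half_space fun_eq_iff)
    then show ?case
      using sum_lessThan_telescope[of "\<lambda>k. f (y k s)" n] by simp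
  qed
  moreover have "f ?x + (\<Sum>k<n. f (y (Suc k) t) - f (y k t)) = f ?x"
    by (simp add: y_def)
  ultimately have "((\<lambda>s. f (\<gamma> s)) has_real_derivative 0 + (\<Sum>k<n. partial A k f ?x * w k)) ?F"
    by (subst (asm) has_field_derivative_cong_eventually[where g = "\<lambda>s. f (\<gamma> s)"]) assumption+
  then show ?thesis
    by simp
qed

section \<open>Functions along integral curves\<close>

text \<open>
  An integral curve solves the differential equation in every chart, so the chart picked by
  \<^const>\<open>derivative_along\<close> at \<open>c t\<close> can be used. By continuity the curve stays in its domain near \<open>t\<close>,
  and the chain rule applies to the coordinate curve.
\<close>

theorem has_real_derivative_along_integral_curve:
  assumes M: "smooth_manifold M" and g: "C1_function M g"
    and c: "integral_curve M X a b c" and t: "t \<in> {a..b}"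
  shows "((\<lambda>s. g (c s)) has_real_derivative derivative_along M g (c t) (X (c t))) (at t within {a..b})"
proof -
  have cont: "continuous_map (top_of_set {a..b}) (mf_top M) c"
    using c by (simp add: integral_curve_def)
  define \<kappa> where "\<kappa> = (SOME \<kappa>. \<kappa> \<in> mf_atlas M \<and> c t \<in> fst \<kappa>)"
  have "c t \<in> points M"
    using continuous_map_image_subset_topspace[OF cont] t by auto
  then have "\<exists>\<kappa>. \<kappa> \<in> mf_atlas M \<and> c t \<in> fst \<kappa>"
    using M unfolding smooth_manifold_def by blast
  then have \<kappa>: "\<kappa> \<in> mf_atlas M" "c t \<in> fst \<kappa>"
    unfolding \<kappa>_def by (metis (mono_tags, lifting) someI_ex)+
  have chart: "is_chart M \<kappa>"
    using M \<kappa> by (simp add: smooth_manifold_def)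
  let ?A = "chart_image \<kappa> (fst \<kappa>)"
  have "inj_on (snd \<kappa>) (topspace (subtopology (mf_top M) (fst \<kappa>)))"
    using chart homeomorphic_imp_injective_map unfolding is_chart_def by blast
  moreover have "topspace (subtopology (mf_top M) (fst \<kappa>)) = fst \<kappa>"
    using chart openin_subset unfolding is_chart_def by (metis topspace_subtopology_subset)
  ultimately have inj: "inj_on (snd \<kappa>) (fst \<kappa>)"
    by simp
  have eq: "in_chart \<kappa> g (snd \<kappa> p) = g p" if "p \<in> fst \<kappa>" for p
    using inj that by (simp add: in_chart_def)
  have "limitin (mf_top M) c (c t) (at t within {a..b})"
  proof -
    have "limitin (top_of_set {a..b}) (\<lambda>s. s) t (at t within {a..b})"
      using t by (simp add: limitin_subtopology eventually_at_filter)
    from continuous_map_limit[OF cont this] show ?thesis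
      by (simp add: o_def)
  qed
  then have near: "\<forall>\<^sub>F s in at t within {a..b}. c s \<in> fst \<kappa>"
    using chart \<kappa> by (simp add: limitin_def is_chart_def)
  have "((\<lambda>s. in_chart \<kappa> g (snd \<kappa> (c s))) has_real_derivative
      (\<Sum>i<mf_dim M. partial ?A i (in_chart \<kappa> g) (snd \<kappa> (c t)) * X (c t) \<kappa> i)) (at t within {a..b})"
  proof (rule half_space_chain_rule)
    show "openin (half_space (mf_dim M)) ?A"
      using chart by (simp add: is_chart_def chart_image_def)
    show "Ck_on (mf_dim M) 1 ?A (in_chart \<kappa> g)"
      using g \<kappa> unfolding C1_function_def by blast
    show "\<forall>\<^sub>F s in at t within {a..b}. snd \<kappa> (c s) \<in> ?A"
      using near by eventually_elim (simp add: chart_image_def)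
    show "snd \<kappa> (c t) \<in> ?A"
      using \<kappa> by (simp add: chart_image_def)
    show "((\<lambda>s. snd \<kappa> (c s) i) has_real_derivative X (c t) \<kappa> i) (at t within {a..b})"
      if "i < mf_dim M" for i
      using c t \<kappa> that unfolding integral_curve_def by blast
  qed
  moreover have "\<forall>\<^sub>F s in at t within {a..b}. in_chart \<kappa> g (snd \<kappa> (c s)) = g (c s)"
    using near by eventually_elim (rule eq)
  moreover note eq[OF \<kappa>(2)]
  ultimately have "((\<lambda>s. g (c s)) has_real_derivative
      (\<Sum>i<mf_dim M. partial ?A i (in_chart \<kappa> g) (snd \<kappa> (c t)) * X (c t) \<kappa> i)) (at t within {a..b})"
    by (subst (asm) has_field_derivative_cong_eventually[where g = "\<lambda>s. g (c s)"]) assumption+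
  then show ?thesis
    by (simp add: derivative_along_def Let_def \<kappa>_def)
qed

corollary decrease_along_integral_curve:
  assumes M: "smooth_manifold M" and g: "C1_function M g"
    and c: "integral_curve M X a b c" and "a \<le> b"
    and le: "\<And>p. p \<in> points M \<Longrightarrow> derivative_along M g p (X p) \<le> r"
  shows "g (c b) \<le> g (c a) + r * (b - a)"
proof -
  have "\<exists>u\<in>{a..b}. g (c b) - g (c a) = derivative_along M g (c u) (X (c u)) * (b - a)"
    using has_real_derivative_along_integral_curve[OF M g c]
    by (intro mvt_very_simple[OF \<open>a \<le> b\<close>, of "\<lambda>s. g (c s)"
          "\<lambda>u h. derivative_along M g (c u) (X (c u)) * h"])
      (simp add: has_field_derivative_def)
  then obtain u where u: "u \<in> {a..b}"
    "g (c b) - g (c a) = derivative_along M g (c u) (X (c u)) * (b - a)" ..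
  have "continuous_map (top_of_set {a..b}) (mf_top M) c"
    using c by (simp add: integral_curve_def)
  then have "c u \<in> points M"
    using continuous_map_image_subset_topspace u by fastforce
  then have "derivative_along M g (c u) (X (c u)) * (b - a) \<le> r * (b - a)"
    using le \<open>a \<le> b\<close> by (intro mult_right_mono) auto
  then show ?thesis
    using u by simp
qed

section \<open>Summing the durations\<close>

lemma nonneg_dominated_infsum_le:
  fixes a b :: "nat \<Rightarrow> real"
  assumes "b sums s" and "\<And>k. 0 \<le> b k" and ab: "\<And>k. k \<in> K \<Longrightarrow> 0 \<le> a k \<and> a k \<le> b k"
  shows "a summable_on K" and "infsum a K \<le> s"
proof -
  have fin: "sum a F \<le> s" if "finite F" "F \<subseteq> K" for F
  proof -
    have "sum a F \<le> sum b F"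
      using ab that by (intro sum_mono) auto
    also have "\<dots> \<le> s"
      using assms(1,2) that sum_le_suminf[of b F] by (simp add: sums_iff)
    finally show ?thesis .
  qed
  show "a summable_on K"
    using ab fin by (intro nonneg_bdd_above_summable_on bdd_aboveI[of _ s]) auto
  then show "infsum a K \<le> s"
    using fin by (rule infsum_le_finite_sums)
qed

theorem theorem32:
  fixes H :: "('v, 'e, 'p) hybrid_system"
    and z :: "'v \<times> 'p"
    and d :: "'v \<times> 'p \<Rightarrow> 'v \<times> 'p \<Rightarrow> real"
    and c l :: real
    and \<alpha>\<^sub>c \<alpha>\<^sub>c' \<alpha>\<^sub>d \<alpha>\<^sub>d' :: "real \<Rightarrow> real"
    and Vc Vd :: "'v \<times> 'p \<Rightarrow> real"
    and \<xi> :: "('v, 'p) execution"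
  assumes "hybrid_system H"
    and "semi_metric_on (hs_points H) d"
    and "z \<in> hs_points H" and "forward_invariant H z"
    and "c > 0" and "0 < l" and "l < 1"
    and "class_K \<alpha>\<^sub>c" and "class_K \<alpha>\<^sub>c'" and "class_K \<alpha>\<^sub>d" and "class_K \<alpha>\<^sub>d'"
    and "C1_on_system H Vc" and "C1_on_system H Vd"
    and "\<forall>x\<in>hs_points H. Vc x \<ge> 0 \<and> Vd x \<ge> 0"
    and "\<forall>x\<in>hs_points H. \<alpha>\<^sub>c (d x z) \<le> Vc x \<and> Vc x \<le> \<alpha>\<^sub>c' (d x z)"
    and "\<forall>x\<in>hs_points H. \<alpha>\<^sub>d (d x z) \<le> Vd x \<and> Vd x \<le> \<alpha>\<^sub>d' (d x z)"
    and "\<forall>v\<in>verts (hs_graph H). \<forall>x\<in>points (hs_dom H v).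
           flow_derivative H Vc v x \<le> - c \<and> flow_derivative H Vd v x \<le> 0"
    and "\<forall>e\<in>arcs (hs_graph H). \<forall>x\<in>hs_guard H e.
           Vc (tail (hs_graph H) e, x) = 0 \<and>
           Vd (head (hs_graph H) e, hs_reset H e x) \<le> l * Vd (tail (hs_graph H) e, x) \<and>
           Vc (head (hs_graph H) e, hs_reset H e x) \<le> Vd (tail (hs_graph H) e, x)"
    and "execution H \<xi>"
  shows "ex_duration \<xi> summable_on ex_index \<xi> \<and>
         infsum (ex_duration \<xi>) (ex_index \<xi>)
           \<le> Vc (ex_start \<xi>) / c + Vd (ex_start \<xi>) / (c * (1 - l)) \<and>
         (ex_index \<xi> = UNIV \<longrightarrow> zeno_execution H \<xi>)"
proof -
  let ?\<tau> = "ex_time \<xi>" and ?v = "ex_vert \<xi>" and ?C = "ex_curve \<xi>" and ?K = "ex_index \<xi>"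
  \<comment> \<open>values at the start (\<open>Wc\<close>, \<open>Wd\<close>) and at the end (\<open>Wc'\<close>, \<open>Wd'\<close>) of each trajectory\<close>
  define Wc Wd where "Wc j = Vc (ex_state \<xi> j (?\<tau> j))" and "Wd j = Vd (ex_state \<xi> j (?\<tau> j))" for j
  define Wc' Wd' where "Wc' j = Vc (ex_state \<xi> j (?\<tau> (Suc j)))"
    and "Wd' j = Vd (ex_state \<xi> j (?\<tau> (Suc j)))" for j
  note c_pos = \<open>c > 0\<close>
  have K_down: "k \<in> ?K" if "Suc k \<in> ?K" for k
    using \<open>execution H \<xi>\<close> that unfolding execution_def by auto
  have K_0: "0 \<in> ?K"
    using \<open>execution H \<xi>\<close> unfolding execution_def by auto
  have flow: "0 \<le> Wc j \<and> 0 \<le> Wd j \<and> 0 \<le> Wc' j \<and> 0 \<le> ex_duration \<xi> j \<and>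
      Wc' j \<le> Wc j - c * ex_duration \<xi> j \<and> Wd' j \<le> Wd j" if j: "j \<in> ?K" for j
  proof -
    let ?M = "hs_dom H (?v j)"
    have \<tau>: "?\<tau> j \<le> ?\<tau> (Suc j)" and v: "?v j \<in> verts (hs_graph H)"
      and C: "integral_curve ?M (hs_field H (?v j)) (?\<tau> j) (?\<tau> (Suc j)) (?C j)"
      using \<open>execution H \<xi>\<close> j by (auto simp: execution_def)
    have M: "smooth_manifold ?M"
      using \<open>hybrid_system H\<close> v by (simp add: hybrid_system_def)
    have "?C j t \<in> points ?M" if "t \<in> {?\<tau> j..?\<tau> (Suc j)}" for t
      using C that continuous_map_image_subset_topspace unfolding integral_curve_def by fastforce
    then have "ex_state \<xi> j t \<in> hs_points H" if "t \<in> {?\<tau> j..?\<tau> (Suc j)}" for t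
      using v that by (auto simp: hs_points_def ex_state_def)
    then have nonneg: "0 \<le> Wc j" "0 \<le> Wd j" "0 \<le> Wc' j"
      using \<open>\<forall>x\<in>hs_points H. Vc x \<ge> 0 \<and> Vd x \<ge> 0\<close> \<tau> unfolding Wc_def Wd_def Wc'_def by auto
    have C1: "C1_function ?M (\<lambda>x. Vc (?v j, x))" "C1_function ?M (\<lambda>x. Vd (?v j, x))"
      using \<open>C1_on_system H Vc\<close> \<open>C1_on_system H Vd\<close> v by (auto simp: C1_on_system_def)
    have "derivative_along ?M (\<lambda>x. Vc (?v j, x)) p (hs_field H (?v j) p) \<le> - c"
      and "derivative_along ?M (\<lambda>x. Vd (?v j, x)) p (hs_field H (?v j) p) \<le> 0"
      if "p \<in> points ?M" for p
      using assms(17) v that by (auto simp: flow_derivative_def)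
    then have "Wc' j \<le> Wc j + (- c) * (?\<tau> (Suc j) - ?\<tau> j)" "Wd' j \<le> Wd j + 0 * (?\<tau> (Suc j) - ?\<tau> j)"
      using decrease_along_integral_curve[OF M C1(1) C \<tau>] decrease_along_integral_curve[OF M C1(2) C \<tau>]
      unfolding Wc_def Wd_def Wc'_def Wd'_def ex_state_def by blast+
    then show ?thesis
      using nonneg \<tau> by (simp add: ex_duration_def)
  qed
  have jump: "Wd (Suc k) \<le> l * Wd' k \<and> Wc (Suc k) \<le> Wd' k" if k: "Suc k \<in> ?K" for k
  proof -
    obtain e where "e \<in> arcs (hs_graph H)" "tail (hs_graph H) e = ?v k"
      "head (hs_graph H) e = ?v (Suc k)" "?C k (?\<tau> (Suc k)) \<in> hs_guard H e"
      "?C (Suc k) (?\<tau> (Suc k)) = hs_reset H e (?C k (?\<tau> (Suc k)))"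
      using \<open>execution H \<xi>\<close> k K_down[OF k] unfolding execution_def by blast
    then show ?thesis
      using assms(18) unfolding Wc_def Wd_def Wd'_def ex_state_def by metis
  qed
  have geometric: "Wd k \<le> l ^ k * Wd 0" if "k \<in> ?K" for k
    using that
  proof (induction k)
    case (Suc k)
    then have k: "k \<in> ?K"
      using K_down[of k] Suc.prems by simp
    have "Wd (Suc k) \<le> l * Wd' k"
      using jump[OF Suc.prems] by simp
    also have "\<dots> \<le> l * (l ^ k * Wd 0)"
      using flow[OF k] Suc.IH[OF k] \<open>0 < l\<close> by (intro mult_left_mono) auto
    finally show ?case
      by simp
  qed simp
  define b where "b k = (case k of 0 \<Rightarrow> Wc 0 / c | Suc m \<Rightarrow> l ^ m * (Wd 0 / c))" for k
  have b_sums: "b sums (Vc (ex_start \<xi>) / c + Vd (ex_start \<xi>) / (c * (1 - l)))"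
  proof -
    have "(\<lambda>m. l ^ m * (Wd 0 / c)) sums (1 / (1 - l) * (Wd 0 / c))"
      using \<open>0 < l\<close> \<open>l < 1\<close> by (intro sums_mult2 geometric_sums) simp
    then have "b sums (1 / (1 - l) * (Wd 0 / c) + b 0)"
      by (intro sums_Suc) (simp add: b_def)
    then show ?thesis
      by (simp add: b_def Wc_def Wd_def ex_start_def mult.commute add.commute)
  qed
  have b_nonneg: "0 \<le> b k" for k
    using flow[OF K_0] c_pos \<open>0 < l\<close> by (cases k) (auto simp: b_def)
  have duration: "0 \<le> ex_duration \<xi> k \<and> ex_duration \<xi> k \<le> b k" if k: "k \<in> ?K" for k
  proof -
    have "c * ex_duration \<xi> k \<le> Wc k"
      using flow[OF k] by linarith
    also have "\<dots> \<le> c * b k"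
    proof (cases k)
      case (Suc m)
      then have m: "m \<in> ?K"
        using k K_down by blast
      have "Wc k \<le> l ^ m * Wd 0"
        using jump[of m] flow[OF m] geometric[OF m] k unfolding Suc by linarith
      then show ?thesis
        using c_pos Suc by (simp add: b_def)
    qed (use c_pos in \<open>simp add: b_def\<close>)
    finally show ?thesis
      using flow[OF k] c_pos by simp
  qed
  note bound = nonneg_dominated_infsum_le[OF b_sums b_nonneg duration]
  moreover have "zeno_execution H \<xi>" if "?K = UNIV"
  proof -
    have "summable (ex_duration \<xi>)"
      using bound(1) that by (simp add: summable_on_imp_summable)
    then have "convergent (\<lambda>n. ?\<tau> n - ?\<tau> 0)"
      using sum_lessThan_telescope[of ?\<tau>] by (simp add: summable_iff_convergent ex_duration_def)
    then have "convergent ?\<tau>"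
      using convergent_add[OF _ convergent_const[of "?\<tau> 0"]] by fastforce
    then show ?thesis
      using \<open>execution H \<xi>\<close> that by (simp add: zeno_execution_def)
  qed
  ultimately show ?thesis
    by blast
qed

end
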